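(* The logic $\mathsf{S4I}$ has the finite model property: for every formula $\varphi$, if $\mathsf{S4I}\nvdash\varphi$, then there is an $\mathsf{S4I}$-model $\mathcal M$ with finitely many worlds such that $\mathcal M\not\models\varphi$.
   Context: Fix a countably infinite set $\mathbb P$ of propositional variables. Formulas: $\varphi,\psi ::= p\mid\bot\mid(\varphi\wedge\psi)\mid(\varphi\vee\psi)\mid(\varphi\to\psi)\mid\Diamond\varphi\mid\Box\varphi$; $\neg\varphi:=\varphi\to\bot$. A bi-intuitionistic frame is $(W,W_\bot,\preccurlyeq,\sqsubseteq)$ with $\preccurlyeq,\sqsubseteq$ preorders on $W$ and $W_\bot\subseteq W$ upward closed under both; infallible if $W_\bot=\varnothing$. A valuation $V:\mathbb P\to 2^W$ has each $V(p)$ upward closed under $\preccurlyeq$ and containing $W_\bot$; a model is $\mathcal M=(W,W_\bot,\preccurlyeq,\sqsubseteq,V)$. Satisfaction: $p$ iff $w\in V(p)$; $\bot$ iff $w\in W_\bot$; $\wedge,\vee$ pointwise; $w\models\varphi\to\psi$ iff for all $v\succcurlyeq w$, $v\models\varphi$ implies $v\models\psi$; $w\models\Diamond\varphi$ iff for all $u\succcurlyeq w$ there is $v\sqsupseteq u$ with $v\models\varphi$; $w\models\Box\varphi$ iff $v\models\varphi$ whenever $w\preccurlyeq u\sqsubseteq v$. $\mathcal M\models\varphi$ iff $\varphi$ holds at every $w\in W\setminus W_\bot$. $\sqsubseteq$ is forward confluent if $w\preccurlyeq w'$ and $w\sqsubseteq v$ imply some $v'$ with $v\preccurlyeq v'$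 and $w'\sqsubseteq v'$; downward confluent if $w\preccurlyeq v\sqsubseteq v'$ implies some $w'$ with $w\sqsubseteq w'\preccurlyeq v'$. An $\mathsf{S4I}$-frame is an infallible bi-intuitionistic frame in which $\sqsubseteq$ is forward and downward confluent; an $\mathsf{S4I}$-model is a model on such a frame. $\mathsf{CS4}$ is the least set of formulas containing all intuitionistic propositional tautologies and all instances of $\Box(\varphi\to\psi)\to(\Box\varphi\to\Box\psi)$, $\Box(\varphi\to\psi)\to(\Diamond\varphi\to\Diamond\psi)$, $\Box\varphi\to\varphi$, $\varphi\to\Diamond\varphi$, $\Box\varphi\to\Box\Box\varphi$, $\Diamond\Diamond\varphi\to\Diamond\varphi$, closed under modus ponens and necessitation. $\mathsf{S4I}$ is $\mathsf{CS4}$ extended with all instances of $\Diamond(\varphi\vee\psi)\to\Diamond\varphi\vee\Diamond\psi$, $\neg\Diamond\bot$, and $\Box(\varphi\vee\psi)\to\Box\varphi\vee\Diamond\psi$ (closed under the same rules). *)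

theory Defs
  imports Main
begin

datatype fm =
    Var nat
  | Bot
  | Conj fm fm
  | Disj fm fm
  | Imp fm fm
  | Dia fm
  | Box fm

definition Neg :: "fm \<Rightarrow> fm" where
  "Neg \<phi> = Imp \<phi> Bot"

text \<open>A (bi-intuitionistic) structure is given by a carrier W, the fallible worlds Wb,
  the intuitionistic preorder R (\<preccurlyeq>) and the modal preorder S (\<sqsubseteq>), both restricted to W.\<close>

definition preorder_on :: "'w set \<Rightarrow> ('w \<Rightarrow> 'w \<Rightarrow> bool) \<Rightarrow> bool" where
  "preorder_on W R \<longleftrightarrow>
     (\<forall>x y. R x y \<longrightarrow> x \<in> W \<and> y \<in> W) \<and>
     (\<forall>x\<in>W. R x x) \<and>
     (\<forall>x y z. R x y \<longrightarrow> R y z \<longrightarrow> R x z)"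

definition up_closed :: "'w set \<Rightarrow> ('w \<Rightarrow> 'w \<Rightarrow> bool) \<Rightarrow> 'w set \<Rightarrow> bool" where
  "up_closed W R A \<longleftrightarrow> A \<subseteq> W \<and> (\<forall>x y. x \<in> A \<longrightarrow> R x y \<longrightarrow> y \<in> A)"

definition bi_int_frame ::
  "'w set \<Rightarrow> 'w set \<Rightarrow> ('w \<Rightarrow> 'w \<Rightarrow> bool) \<Rightarrow> ('w \<Rightarrow> 'w \<Rightarrow> bool) \<Rightarrow> bool" where
  "bi_int_frame W Wb R S \<longleftrightarrow>
     preorder_on W R \<and> preorder_on W S \<and> up_closed W R Wb \<and> up_closed W S Wb"

definition infallible :: "'w set \<Rightarrow> bool" where
  "infallible Wb \<longleftrightarrow> Wb = {}"

definition valuation ::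
  "'w set \<Rightarrow> 'w set \<Rightarrow> ('w \<Rightarrow> 'w \<Rightarrow> bool) \<Rightarrow> (nat \<Rightarrow> 'w set) \<Rightarrow> bool" where
  "valuation W Wb R V \<longleftrightarrow> (\<forall>p. up_closed W R (V p) \<and> Wb \<subseteq> V p)"

definition forward_confluent ::
  "'w set \<Rightarrow> ('w \<Rightarrow> 'w \<Rightarrow> bool) \<Rightarrow> ('w \<Rightarrow> 'w \<Rightarrow> bool) \<Rightarrow> bool" where
  "forward_confluent W R S \<longleftrightarrow>
     (\<forall>w w' v. R w w' \<longrightarrow> S w v \<longrightarrow> (\<exists>v'\<in>W. R v v' \<and> S w' v'))"

definition downward_confluent ::
  "'w set \<Rightarrow> ('w \<Rightarrow> 'w \<Rightarrow> bool) \<Rightarrow> ('w \<Rightarrow> 'w \<Rightarrow> bool) \<Rightarrow> bool" where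
  "downward_confluent W R S \<longleftrightarrow>
     (\<forall>w v v'. R w v \<longrightarrow> S v v' \<longrightarrow> (\<exists>w'\<in>W. S w w' \<and> R w' v'))"

definition S4I_frame ::
  "'w set \<Rightarrow> 'w set \<Rightarrow> ('w \<Rightarrow> 'w \<Rightarrow> bool) \<Rightarrow> ('w \<Rightarrow> 'w \<Rightarrow> bool) \<Rightarrow> bool" where
  "S4I_frame W Wb R S \<longleftrightarrow>
     bi_int_frame W Wb R S \<and> infallible Wb \<and>
     forward_confluent W R S \<and> downward_confluent W R S"

definition S4I_model ::
  "'w set \<Rightarrow> 'w set \<Rightarrow> ('w \<Rightarrow> 'w \<Rightarrow> bool) \<Rightarrow> ('w \<Rightarrow> 'w \<Rightarrow> bool) \<Rightarrow> (nat \<Rightarrow> 'w set) \<Rightarrow> bool" where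
  "S4I_model W Wb R S V \<longleftrightarrow> S4I_frame W Wb R S \<and> valuation W Wb R V"

fun sat ::
  "'w set \<Rightarrow> 'w set \<Rightarrow> ('w \<Rightarrow> 'w \<Rightarrow> bool) \<Rightarrow> ('w \<Rightarrow> 'w \<Rightarrow> bool) \<Rightarrow> (nat \<Rightarrow> 'w set)
   \<Rightarrow> 'w \<Rightarrow> fm \<Rightarrow> bool" where
  "sat W Wb R S V w (Var p) \<longleftrightarrow> w \<in> V p"
| "sat W Wb R S V w Bot \<longleftrightarrow> w \<in> Wb"
| "sat W Wb R S V w (Conj \<phi> \<psi>) \<longleftrightarrow> sat W Wb R S V w \<phi> \<and> sat W Wb R S V w \<psi>"
| "sat W Wb R S V w (Disj \<phi> \<psi>) \<longleftrightarrow> sat W Wb R S V w \<phi> \<or> sat W Wb R S V w \<psi>"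
| "sat W Wb R S V w (Imp \<phi> \<psi>) \<longleftrightarrow>
     (\<forall>v\<in>W. R w v \<longrightarrow> sat W Wb R S V v \<phi> \<longrightarrow> sat W Wb R S V v \<psi>)"
| "sat W Wb R S V w (Dia \<phi>) \<longleftrightarrow>
     (\<forall>u\<in>W. R w u \<longrightarrow> (\<exists>v\<in>W. S u v \<and> sat W Wb R S V v \<phi>))"
| "sat W Wb R S V w (Box \<phi>) \<longleftrightarrow>
     (\<forall>u\<in>W. \<forall>v\<in>W. R w u \<longrightarrow> S u v \<longrightarrow> sat W Wb R S V v \<phi>)"

definition valid_in_model ::
  "'w set \<Rightarrow> 'w set \<Rightarrow> ('w \<Rightarrow> 'w \<Rightarrow> bool) \<Rightarrow> ('w \<Rightarrow> 'w \<Rightarrow> bool) \<Rightarrow> (nat \<Rightarrow> 'w set)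
   \<Rightarrow> fm \<Rightarrow> bool" where
  "valid_in_model W Wb R S V \<phi> \<longleftrightarrow> (\<forall>w\<in>W - Wb. sat W Wb R S V w \<phi>)"

text \<open>Intuitionistic propositional tautologies (in the modal language) are generated by
  the standard Hilbert axiom schemes for IPC, instantiated with arbitrary modal formulas,
  together with modus ponens.\<close>

inductive S4I_deriv :: "fm \<Rightarrow> bool" where
  ipc1: "S4I_deriv (Imp \<phi> (Imp \<psi> \<phi>))"
| ipc2: "S4I_deriv (Imp (Imp \<phi> (Imp \<psi> \<chi>)) (Imp (Imp \<phi> \<psi>) (Imp \<phi> \<chi>)))"
| ipc3: "S4I_deriv (Imp (Conj \<phi> \<psi>) \<phi>)"
| ipc4: "S4I_deriv (Imp (Conj \<phi> \<psi>) \<psi>)"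
| ipc5: "S4I_deriv (Imp \<phi> (Imp \<psi> (Conj \<phi> \<psi>)))"
| ipc6: "S4I_deriv (Imp \<phi> (Disj \<phi> \<psi>))"
| ipc7: "S4I_deriv (Imp \<psi> (Disj \<phi> \<psi>))"
| ipc8: "S4I_deriv (Imp (Imp \<phi> \<chi>) (Imp (Imp \<psi> \<chi>) (Imp (Disj \<phi> \<psi>) \<chi>)))"
| ipc9: "S4I_deriv (Imp Bot \<phi>)"
| kbox: "S4I_deriv (Imp (Box (Imp \<phi> \<psi>)) (Imp (Box \<phi>) (Box \<psi>)))"
| kdia: "S4I_deriv (Imp (Box (Imp \<phi> \<psi>)) (Imp (Dia \<phi>) (Dia \<psi>)))"
| tbox: "S4I_deriv (Imp (Box \<phi>) \<phi>)"
| tdia: "S4I_deriv (Imp \<phi> (Dia \<phi>))"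
| fourbox: "S4I_deriv (Imp (Box \<phi>) (Box (Box \<phi>)))"
| fourdia: "S4I_deriv (Imp (Dia (Dia \<phi>)) (Dia \<phi>))"
| cd: "S4I_deriv (Imp (Dia (Disj \<phi> \<psi>)) (Disj (Dia \<phi>) (Dia \<psi>)))"
| ndbot: "S4I_deriv (Neg (Dia Bot))"
| boxdisj: "S4I_deriv (Imp (Box (Disj \<phi> \<psi>)) (Disj (Box \<phi>) (Dia \<psi>)))"
| mp: "S4I_deriv (Imp \<phi> \<psi>) \<Longrightarrow> S4I_deriv \<phi> \<Longrightarrow> S4I_deriv \<psi>"
| nec: "S4I_deriv \<phi> \<Longrightarrow> S4I_deriv (Box \<phi>)"

end

theory Submission
  imports Defs "HOL-Library.FSet" "HOL-Library.Sublist"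
begin

text \<open>
  The canonical model, whose worlds are prime theories, is an S4I-model that refutes every underivable
  formula. To make it finite, let \<open>\<Sigma>\<close> be the set of subformulas of \<open>\<phi>\<close> and label each world with the
  members of \<open>\<Sigma>\<close> that it satisfies. Unravel each world into the tree of strictly label-increasing
  intuitionistic chains above it, identifying equal subtrees with the same parent; only finitely many
  trees arise. The worlds of the finite model are the nodes of these trees, ordered within each tree.
  A node sees modally its images under monotone maps between trees that preserve boxes forward and
  reflect diamonds, and such maps satisfy both confluence conditions trivially.
  The truth lemma needs enough such maps: a tree realised by worlds \<open>f\<close>, together with a modal
  successor of one of its nodes, can be moved as a whole along the modal relation, by downward confluence
  from that node to the root and then by forward confluence to all other nodes. Contracting
  steps at which the label of the moved tree stays constant maps it into the tree of its new root.
\<close>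

section \<open>Theories and prime theories\<close>

definition deductive :: "fm set \<Rightarrow> bool" where
  "deductive \<Gamma> \<longleftrightarrow> (\<forall>\<phi>. S4I_deriv \<phi> \<longrightarrow> \<phi> \<in> \<Gamma>) \<and> (\<forall>\<phi> \<psi>. Imp \<phi> \<psi> \<in> \<Gamma> \<longrightarrow> \<phi> \<in> \<Gamma> \<longrightarrow> \<psi> \<in> \<Gamma>)"

lemma deductive_deriv: "deductive \<Gamma> \<Longrightarrow> S4I_deriv \<phi> \<Longrightarrow> \<phi> \<in> \<Gamma>"
  by (simp add: deductive_def)

lemma deductive_mp: "deductive \<Gamma> \<Longrightarrow> Imp \<phi> \<psi> \<in> \<Gamma> \<Longrightarrow> \<phi> \<in> \<Gamma> \<Longrightarrow> \<psi> \<in> \<Gamma>"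
  unfolding deductive_def by blast

lemma deductive_mp_deriv: "deductive \<Gamma> \<Longrightarrow> S4I_deriv (Imp \<phi> \<psi>) \<Longrightarrow> \<phi> \<in> \<Gamma> \<Longrightarrow> \<psi> \<in> \<Gamma>"
  unfolding deductive_def by blast

lemma deductive_deriv_set: "deductive {\<phi>. S4I_deriv \<phi>}"
  unfolding deductive_def using S4I_deriv.mp by blast

context
  fixes \<Gamma> :: "fm set"
  assumes ded: "deductive \<Gamma>"
begin

lemma deductive_Imp_const: "\<psi> \<in> \<Gamma> \<Longrightarrow> Imp \<phi> \<psi> \<in> \<Gamma>"
  using ded deductive_mp_deriv ipc1 by blast

lemma deductive_Imp_mp:
  "Imp \<phi> (Imp \<psi> \<chi>) \<in> \<Gamma> \<Longrightarrow> Imp \<phi> \<psi> \<in> \<Gamma> \<Longrightarrow> Imp \<phi> \<chi> \<in> \<Gamma>"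
  using ded deductive_mp deductive_mp_deriv ipc2 by blast

lemma deductive_Imp_trans: "Imp \<phi> \<psi> \<in> \<Gamma> \<Longrightarrow> Imp \<psi> \<chi> \<in> \<Gamma> \<Longrightarrow> Imp \<phi> \<chi> \<in> \<Gamma>"
  using deductive_Imp_const deductive_Imp_mp by blast

lemma deductive_Imp_refl: "Imp \<phi> \<phi> \<in> \<Gamma>"
  using deductive_Imp_mp deductive_deriv[OF ded] ipc1 by blast

lemma deductive_Conj: "Conj \<phi> \<psi> \<in> \<Gamma> \<longleftrightarrow> \<phi> \<in> \<Gamma> \<and> \<psi> \<in> \<Gamma>"
  using ded deductive_mp deductive_mp_deriv ipc3 ipc4 ipc5 by meson

lemma deductive_Disj_elim: "Imp \<phi> \<chi> \<in> \<Gamma> \<Longrightarrow> Imp \<psi> \<chi> \<in> \<Gamma> \<Longrightarrow> Imp (Disj \<phi> \<psi>) \<chi> \<in> \<Gamma>"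
  using ded deductive_mp deductive_mp_deriv ipc8 by blast

lemma deductive_Disj_left: "Imp \<phi> \<psi> \<in> \<Gamma> \<Longrightarrow> Imp \<phi> (Disj \<psi> \<chi>) \<in> \<Gamma>"
  using deductive_Imp_trans deductive_deriv[OF ded ipc6] by blast

lemma deductive_Disj_right: "Imp \<phi> \<chi> \<in> \<Gamma> \<Longrightarrow> Imp \<phi> (Disj \<psi> \<chi>) \<in> \<Gamma>"
  using deductive_Imp_trans deductive_deriv[OF ded ipc7] by blast

lemma deductive_Disj_mono:
  "Imp \<phi> \<phi>' \<in> \<Gamma> \<Longrightarrow> Imp \<psi> \<psi>' \<in> \<Gamma> \<Longrightarrow> Imp (Disj \<phi> \<psi>) (Disj \<phi>' \<psi>') \<in> \<Gamma>"
  using deductive_Disj_elim deductive_Disj_left deductive_Disj_right by blast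

lemma deductive_Conj_left: "Imp \<phi> \<chi> \<in> \<Gamma> \<Longrightarrow> Imp (Conj \<phi> \<psi>) \<chi> \<in> \<Gamma>"
  using deductive_Imp_trans deductive_deriv[OF ded ipc3] by blast

lemma deductive_Conj_right: "Imp \<psi> \<chi> \<in> \<Gamma> \<Longrightarrow> Imp (Conj \<phi> \<psi>) \<chi> \<in> \<Gamma>"
  using deductive_Imp_trans deductive_deriv[OF ded ipc4] by blast

text \<open>This is the theory generated by \<Gamma> and \<phi>, in deduction-theorem form.\<close>

lemma deductive_adjoin: "deductive {\<psi>. Imp \<phi> \<psi> \<in> \<Gamma>}"
  unfolding deductive_def
  using deductive_Imp_const deductive_deriv[OF ded] deductive_Imp_mp by blast

lemma deductive_Box: "deductive {\<phi>. Box \<phi> \<in> \<Gamma>}"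
  unfolding deductive_def
  using ded nec deductive_deriv deductive_mp deductive_mp_deriv kbox by blast

end

text \<open>The theory generated by \<Gamma> and \<Delta> together: \<Delta> is closed under
  conjunction, so a single \<delta> can replace any finite list of premises from \<Delta>.\<close>

lemma deductive_join:
  assumes "deductive \<Gamma>" "deductive \<Delta>"
  shows "deductive {\<psi>. \<exists>\<delta>\<in>\<Delta>. Imp \<delta> \<psi> \<in> \<Gamma>}"
  unfolding deductive_def
proof (intro conjI allI impI)
  fix \<phi> assume "S4I_deriv \<phi>"
  then show "\<phi> \<in> {\<psi>. \<exists>\<delta>\<in>\<Delta>. Imp \<delta> \<psi> \<in> \<Gamma>}"
    using assms deductive_deriv deductive_Imp_refl by blast
next
  fix \<phi> \<psi>
  assume "Imp \<phi> \<psi> \<in> {\<psi>. \<exists>\<delta>\<in>\<Delta>. Imp \<delta> \<psi> \<in> \<Gamma>}" "\<phi> \<in> {\<psi>. \<exists>\<delta>\<in>\<Delta>. Imp \<delta> \<psi> \<in> \<Gamma>}"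
  then obtain \<delta> \<delta>' where "\<delta> \<in> \<Delta>" "\<delta>' \<in> \<Delta>" "Imp \<delta> (Imp \<phi> \<psi>) \<in> \<Gamma>" "Imp \<delta>' \<phi> \<in> \<Gamma>" by blast
  then have "Conj \<delta> \<delta>' \<in> \<Delta>" "Imp (Conj \<delta> \<delta>') \<psi> \<in> \<Gamma>"
    using assms deductive_Conj deductive_Conj_left deductive_Conj_right deductive_Imp_mp by blast+
  then show "\<psi> \<in> {\<psi>. \<exists>\<delta>\<in>\<Delta>. Imp \<delta> \<psi> \<in> \<Gamma>}" by blast
qed

definition prime_theory :: "fm set \<Rightarrow> bool" where
  "prime_theory \<Gamma> \<longleftrightarrow> deductive \<Gamma> \<and> Bot \<notin> \<Gamma> \<and> (\<forall>\<phi> \<psi>. Disj \<phi> \<psi> \<in> \<Gamma> \<longrightarrow> \<phi> \<in> \<Gamma> \<or> \<psi> \<in> \<Gamma>)"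

lemma prime_theory_deductive: "prime_theory \<Gamma> \<Longrightarrow> deductive \<Gamma>"
  by (simp add: prime_theory_def)

lemma prime_theory_Disj: "prime_theory \<Gamma> \<Longrightarrow> Disj \<phi> \<psi> \<in> \<Gamma> \<longleftrightarrow> \<phi> \<in> \<Gamma> \<or> \<psi> \<in> \<Gamma>"
  unfolding prime_theory_def using deductive_mp_deriv ipc6 ipc7 by blast

lemma prime_theory_Dia_Disj:
  assumes "prime_theory \<Gamma>" "Dia (Disj \<phi> \<psi>) \<in> \<Gamma>"
  shows "Dia \<phi> \<in> \<Gamma> \<or> Dia \<psi> \<in> \<Gamma>"
  using assms prime_theory_deductive deductive_mp_deriv cd prime_theory_Disj by blast

lemma prime_theory_Dia_Bot: "prime_theory \<Gamma> \<Longrightarrow> Dia Bot \<notin> \<Gamma>"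
  using prime_theory_def deductive_mp_deriv ndbot unfolding Neg_def by blast

text \<open>The prime filter theorem: Zorn's lemma gives a theory that is maximal among those
  extending \<Gamma> and missing \<open>I\<close>, and maximality forces primeness. Closure of
  \<open>I\<close> under disjunction is the only ideal property assumed.\<close>

lemma prime_theory_exists:
  assumes "deductive \<Gamma>" "I \<noteq> {}" "\<And>\<phi> \<psi>. \<phi> \<in> I \<Longrightarrow> \<psi> \<in> I \<Longrightarrow> Disj \<phi> \<psi> \<in> I" "\<Gamma> \<inter> I = {}"
  obtains \<Delta> where "prime_theory \<Delta>" "\<Gamma> \<subseteq> \<Delta>" "\<Delta> \<inter> I = {}"
proof -
  define \<A> where "\<A> = {\<Delta>. deductive \<Delta> \<and> \<Gamma> \<subseteq> \<Delta> \<and> \<Delta> \<inter> I = {}}"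
  have "\<exists>M\<in>\<A>. \<forall>X\<in>\<A>. M \<subseteq> X \<longrightarrow> X = M"
  proof (rule subset_Zorn_nonempty)
    show "\<A> \<noteq> {}" using assms(1,4) by (auto simp: \<A>_def)
  next
    fix \<C> assume \<C>: "\<C> \<noteq> {}" "subset.chain \<A> \<C>"
    have \<C>\<A>: "deductive X" "\<Gamma> \<subseteq> X" "X \<inter> I = {}" if "X \<in> \<C>" for X
      using \<C>(2) that unfolding \<A>_def subset.chain_def by auto
    have "deductive (\<Union>\<C>)"
      unfolding deductive_def
    proof (intro conjI allI impI)
      fix \<phi> assume "S4I_deriv \<phi>"
      then show "\<phi> \<in> \<Union>\<C>"
        using \<C>(1) \<C>\<A>(1) deductive_deriv by (meson UnionI ex_in_conv)
    next
      fix \<phi> \<psi> assume "Imp \<phi> \<psi> \<in> \<Union>\<C>" "\<phi> \<in> \<Union>\<C>"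
      then obtain X Y where XY: "X \<in> \<C>" "Y \<in> \<C>" "Imp \<phi> \<psi> \<in> X" "\<phi> \<in> Y" by blast
      then have "X \<subseteq> Y \<or> Y \<subseteq> X"
        using \<C>(2) unfolding subset.chain_def by blast
      then obtain Z where "Z \<in> \<C>" "Imp \<phi> \<psi> \<in> Z" "\<phi> \<in> Z" using XY by blast
      then show "\<psi> \<in> \<Union>\<C>"
        using deductive_mp[OF \<C>\<A>(1)] by blast
    qed
    then show "\<Union>\<C> \<in> \<A>"
      using \<C>(1) \<C>\<A>(2,3) unfolding \<A>_def by blast
  qed
  then obtain M where M: "M \<in> \<A>" and max: "\<And>X. X \<in> \<A> \<Longrightarrow> M \<subseteq> X \<Longrightarrow> X = M" by blast
  have ded: "deductive M" using M by (simp add: \<A>_def)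
  \<comment> \<open>Otherwise the theory generated by \<open>M\<close> and \<phi> would still miss
    \<open>I\<close>; by maximality it would equal \<open>M\<close>, which would then contain
    \<phi>.\<close>
  have blocked: "\<exists>\<iota>\<in>I. Imp \<phi> \<iota> \<in> M" if "\<phi> \<notin> M" for \<phi>
  proof (rule ccontr)
    let ?X = "{\<psi>. Imp \<phi> \<psi> \<in> M}"
    assume "\<not> ?thesis"
    moreover have "M \<subseteq> ?X" using deductive_Imp_const[OF ded] by blast
    ultimately have "?X \<in> \<A>"
      using M deductive_adjoin[OF ded] by (auto simp: \<A>_def)
    then have "?X = M" using max \<open>M \<subseteq> ?X\<close> by blast
    then show False using that deductive_Imp_refl[OF ded] by blast
  qed
  have "prime_theory M"
    unfolding prime_theory_def
  proof (intro conjI allI impI)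
    \<comment> \<open>A theory containing \<open>Bot\<close> contains every formula, hence a member
      of the nonempty set \<open>I\<close>.\<close>
    show "Bot \<notin> M"
      using M assms(2) deductive_mp_deriv[OF ded ipc9] by (auto simp: \<A>_def)
  next
    fix \<phi> \<psi> assume or: "Disj \<phi> \<psi> \<in> M"
    show "\<phi> \<in> M \<or> \<psi> \<in> M"
    proof (rule ccontr)
      assume "\<not> ?thesis"
      then obtain \<iota> \<kappa> where "\<iota> \<in> I" "\<kappa> \<in> I" "Imp \<phi> \<iota> \<in> M" "Imp \<psi> \<kappa> \<in> M"
        using blocked by blast
      then have "Disj \<iota> \<kappa> \<in> M" "Disj \<iota> \<kappa> \<in> I"
        using deductive_mp[OF ded deductive_Disj_mono[OF ded] or] assms(3) by blast+
      then show False using M by (auto simp: \<A>_def)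
    qed
  qed (rule ded)
  then show thesis using that M by (auto simp: \<A>_def)
qed

text \<open>The ideal consists of the formulas that imply \<phi> over \<Gamma>, and \<phi> is one of
  them.\<close>

lemma prime_theory_avoiding:
  assumes "deductive \<Gamma>" "\<phi> \<notin> \<Gamma>"
  obtains \<Delta> where "prime_theory \<Delta>" "\<Gamma> \<subseteq> \<Delta>" "\<phi> \<notin> \<Delta>"
proof (rule prime_theory_exists[of \<Gamma> "{\<psi>. Imp \<psi> \<phi> \<in> \<Gamma>}"])
  show "{\<psi>. Imp \<psi> \<phi> \<in> \<Gamma>} \<noteq> {}" using deductive_Imp_refl[OF assms(1)] by blast
  show "\<Gamma> \<inter> {\<psi>. Imp \<psi> \<phi> \<in> \<Gamma>} = {}" using deductive_mp assms by blast
  fix \<Delta> assume "prime_theory \<Delta>" "\<Gamma> \<subseteq> \<Delta>" "\<Delta> \<inter> {\<psi>. Imp \<psi> \<phi> \<in> \<Gamma>} = {}"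
  then show thesis using that deductive_Imp_refl[OF assms(1)] by blast
qed (use assms deductive_Disj_elim in auto)

section \<open>The canonical model\<close>

definition canon_worlds :: "fm set set" where
  "canon_worlds = {\<Gamma>. prime_theory \<Gamma>}"

definition canon_int :: "fm set \<Rightarrow> fm set \<Rightarrow> bool" where
  "canon_int \<Gamma> \<Delta> \<longleftrightarrow> prime_theory \<Gamma> \<and> prime_theory \<Delta> \<and> \<Gamma> \<subseteq> \<Delta>"

text \<open>Intuitionistically \<open>Box\<close> and \<open>Dia\<close> are not interdefinable, so
  each needs a clause of its own.\<close>

definition canon_modal :: "fm set \<Rightarrow> fm set \<Rightarrow> bool" where
  "canon_modal \<Gamma> \<Delta> \<longleftrightarrow> prime_theory \<Gamma> \<and> prime_theory \<Delta> \<and>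
     (\<forall>\<phi>. Box \<phi> \<in> \<Gamma> \<longrightarrow> \<phi> \<in> \<Delta>) \<and> (\<forall>\<phi>\<in>\<Delta>. Dia \<phi> \<in> \<Gamma>)"

definition canon_val :: "nat \<Rightarrow> fm set set" where
  "canon_val p = {\<Gamma>. prime_theory \<Gamma> \<and> Var p \<in> \<Gamma>}"

text \<open>The common source of all modal successors. Besides \<open>J\<close>, a successor must
  avoid every \<iota> with \<open>Dia \<iota>\<close> outside \<Gamma>. Axiom \<open>cd\<close>
  makes these formulas closed under disjunction, and \<open>avoid\<close> says exactly that \<Theta>
  misses the ideal they generate with \<open>J\<close>.\<close>

lemma canon_modal_exists:
  assumes "prime_theory \<Gamma>" "deductive \<Theta>" "\<And>\<phi>. Box \<phi> \<in> \<Gamma> \<Longrightarrow> \<phi> \<in> \<Theta>"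
    and J: "J \<noteq> {}" "\<And>\<phi> \<psi>. \<phi> \<in> J \<Longrightarrow> \<psi> \<in> J \<Longrightarrow> Disj \<phi> \<psi> \<in> J"
    and avoid: "\<And>\<kappa> \<iota>. Disj \<kappa> \<iota> \<in> \<Theta> \<Longrightarrow> \<kappa> \<in> J \<Longrightarrow> Dia \<iota> \<in> \<Gamma>"
  obtains \<Delta> where "canon_modal \<Gamma> \<Delta>" "\<Theta> \<subseteq> \<Delta>" "\<Delta> \<inter> J = {}"
proof -
  let ?T = "{\<phi>. S4I_deriv \<phi>}"
  let ?I = "{\<psi>. \<exists>\<kappa>\<in>J. \<exists>\<iota>. Dia \<iota> \<notin> \<Gamma> \<and> S4I_deriv (Imp \<psi> (Disj \<kappa> \<iota>))}"
  note d = deductive_deriv_set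
  obtain \<kappa>0 where \<kappa>0: "\<kappa>0 \<in> J" using J by blast
  \<comment> \<open>Take \<iota> to be \<open>Bot\<close>: axiom \<open>ndbot\<close> keeps
    \<open>Dia Bot\<close> out of \<Gamma>.\<close>
  have JI: "J \<subseteq> ?I"
    using prime_theory_Dia_Bot[OF assms(1)] ipc6 by blast
  have DI: "\<iota> \<in> ?I" if "Dia \<iota> \<notin> \<Gamma>" for \<iota>
    using that \<kappa>0 ipc7 by blast
  have "Disj \<phi> \<psi> \<in> ?I" if "\<phi> \<in> ?I" "\<psi> \<in> ?I" for \<phi> \<psi>
  proof -
    obtain \<kappa> \<iota> \<kappa>' \<iota>' where *: "\<kappa> \<in> J" "\<kappa>' \<in> J" "Dia \<iota> \<notin> \<Gamma>" "Dia \<iota>' \<notin> \<Gamma>"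
      "S4I_deriv (Imp \<phi> (Disj \<kappa> \<iota>))" "S4I_deriv (Imp \<psi> (Disj \<kappa>' \<iota>'))"
      using \<open>\<phi> \<in> ?I\<close> \<open>\<psi> \<in> ?I\<close> by blast
    have "Imp (Disj \<kappa> \<iota>) (Disj (Disj \<kappa> \<kappa>') (Disj \<iota> \<iota>')) \<in> ?T"
      "Imp (Disj \<kappa>' \<iota>') (Disj (Disj \<kappa> \<kappa>') (Disj \<iota> \<iota>')) \<in> ?T"
      by (intro deductive_Disj_mono[OF d]; simp add: ipc6 ipc7)+
    then have "Imp (Disj \<phi> \<psi>) (Disj (Disj \<kappa> \<kappa>') (Disj \<iota> \<iota>')) \<in> ?T"
      using * deductive_Disj_elim[OF d] deductive_Imp_trans[OF d] by blast
    moreover have "Dia (Disj \<iota> \<iota>') \<notin> \<Gamma>" using * prime_theory_Dia_Disj[OF assms(1)] by blast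
    ultimately show ?thesis using * J by blast
  qed
  moreover have "\<Theta> \<inter> ?I = {}"
    using avoid deductive_mp_deriv[OF assms(2)] by blast
  moreover have "?I \<noteq> {}" using JI J by blast
  ultimately obtain \<Delta> where \<Delta>: "prime_theory \<Delta>" "\<Theta> \<subseteq> \<Delta>" "\<Delta> \<inter> ?I = {}"
    using prime_theory_exists[OF assms(2), of ?I] by blast
  have "canon_modal \<Gamma> \<Delta>"
    unfolding canon_modal_def using \<Delta> assms DI by blast
  then show thesis using that \<Delta> JI by blast
qed

text \<open>With no further formulas to avoid, \<open>J\<close> can be the set of formulas whose
  diamond fails in \<Gamma>; it contains \<open>Bot\<close>.\<close>

lemma canon_modal_Dia_exists:
  assumes "prime_theory \<Gamma>" "deductive \<Theta>" "\<And>\<phi>. Box \<phi> \<in> \<Gamma> \<Longrightarrow> \<phi> \<in> \<Theta>"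
    and avoid: "\<And>\<iota>. \<iota> \<in> \<Theta> \<Longrightarrow> Dia \<iota> \<in> \<Gamma>"
  obtains \<Delta> where "canon_modal \<Gamma> \<Delta>" "\<Theta> \<subseteq> \<Delta>"
proof (rule canon_modal_exists[OF assms(1-3), where J = "{\<iota>. Dia \<iota> \<notin> \<Gamma>}"])
  show "{\<iota>. Dia \<iota> \<notin> \<Gamma>} \<noteq> {}" using prime_theory_Dia_Bot assms(1) by blast
qed (use prime_theory_Dia_Disj[OF assms(1)] avoid that in auto)

lemma canon_Imp:
  assumes "prime_theory \<Gamma>" "Imp \<phi> \<psi> \<notin> \<Gamma>"
  obtains \<Delta> where "canon_int \<Gamma> \<Delta>" "\<phi> \<in> \<Delta>" "\<psi> \<notin> \<Delta>"
proof -
  have d: "deductive \<Gamma>" using assms prime_theory_deductive by blast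
  obtain \<Delta> where "prime_theory \<Delta>" "{\<chi>. Imp \<phi> \<chi> \<in> \<Gamma>} \<subseteq> \<Delta>" "\<psi> \<notin> \<Delta>"
    using prime_theory_avoiding[OF deductive_adjoin[OF d]] assms(2) by blast
  then show thesis
    using that[of \<Delta>] assms deductive_Imp_refl[OF d] deductive_Imp_const[OF d]
    unfolding canon_int_def by blast
qed

text \<open>\<Theta> is generated by \<phi> and the formulas boxed in \<Gamma>. Any \<iota> in it
  has \<open>Box (Imp \<phi> \<iota>)\<close> in \<Gamma>, so \<open>kdia\<close> yields
  \<open>Dia \<iota>\<close>.\<close>

lemma canon_Dia:
  assumes "prime_theory \<Gamma>" "Dia \<phi> \<in> \<Gamma>"
  obtains \<Delta> where "canon_modal \<Gamma> \<Delta>" "\<phi> \<in> \<Delta>"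
proof -
  have d: "deductive \<Gamma>" using assms prime_theory_deductive by blast
  note b = deductive_Box[OF d]
  obtain \<Delta> where "canon_modal \<Gamma> \<Delta>" "{\<psi>. Imp \<phi> \<psi> \<in> {\<chi>. Box \<chi> \<in> \<Gamma>}} \<subseteq> \<Delta>"
  proof (rule canon_modal_Dia_exists[OF assms(1) deductive_adjoin[OF b]])
    show "\<iota> \<in> {\<psi>. Imp \<phi> \<psi> \<in> {\<chi>. Box \<chi> \<in> \<Gamma>}} \<Longrightarrow> Dia \<iota> \<in> \<Gamma>" for \<iota>
      using d assms(2) kdia deductive_mp deductive_mp_deriv by blast
  qed (use deductive_Imp_const[OF b] in auto)
  then show thesis using that[of \<Delta>] deductive_Imp_refl[OF b] by blast
qed

text \<open>\<open>J\<close> collects the formulas that provably imply \<phi>. If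
  \<open>Box (Disj \<kappa> \<iota>)\<close> is in \<Gamma> with \<kappa> in \<open>J\<close>, so is
  \<open>Box (Disj \<phi> \<iota>)\<close>; since \<open>Box \<phi>\<close> is not,
  \<open>boxdisj\<close> and primeness leave \<open>Dia \<iota>\<close>.\<close>

lemma canon_Box:
  assumes "prime_theory \<Gamma>" "Box \<phi> \<notin> \<Gamma>"
  obtains \<Delta> where "canon_modal \<Gamma> \<Delta>" "\<phi> \<notin> \<Delta>"
proof -
  note d = deductive_deriv_set
  have g: "deductive \<Gamma>" using assms prime_theory_deductive by blast
  note b = deductive_Box[OF g]
  let ?J = "{\<kappa>. S4I_deriv (Imp \<kappa> \<phi>)}"
  have refl: "\<phi> \<in> ?J" using deductive_Imp_refl[OF d] by blast
  obtain \<Delta> where "canon_modal \<Gamma> \<Delta>" "\<Delta> \<inter> ?J = {}"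
  proof (rule canon_modal_exists[OF assms(1) b, where J = ?J])
    show "Disj \<psi> \<psi>' \<in> ?J" if "\<psi> \<in> ?J" "\<psi>' \<in> ?J" for \<psi> \<psi>'
      using that deductive_Disj_elim[OF d] by blast
    show "Dia \<iota> \<in> \<Gamma>" if or: "Disj \<kappa> \<iota> \<in> {\<chi>. Box \<chi> \<in> \<Gamma>}" and \<kappa>: "\<kappa> \<in> ?J" for \<kappa> \<iota>
    proof -
      have "Imp (Disj \<kappa> \<iota>) (Disj \<phi> \<iota>) \<in> {\<phi>. S4I_deriv \<phi>}"
        using deductive_Disj_mono[OF d] \<kappa> deductive_Imp_refl[OF d] by blast
      then have "Box (Disj \<phi> \<iota>) \<in> \<Gamma>" using deductive_mp_deriv[OF b] or by blast
      then have "Disj (Box \<phi>) (Dia \<iota>) \<in> \<Gamma>" using deductive_mp_deriv[OF g boxdisj] by blast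
      then show ?thesis using prime_theory_Disj[OF assms(1)] assms(2) by blast
    qed
  qed (use refl in auto)
  then show thesis using that refl by blast
qed

lemma canon_preorder_int: "preorder_on canon_worlds canon_int"
  unfolding preorder_on_def canon_int_def canon_worlds_def by blast

lemma canon_preorder_modal: "preorder_on canon_worlds canon_modal"
  unfolding preorder_on_def canon_worlds_def
proof (intro conjI allI impI ballI)
  show "canon_modal x x" if "x \<in> Collect prime_theory" for x
    using that prime_theory_deductive deductive_mp_deriv tbox tdia
    unfolding canon_modal_def by blast
next
  fix x y z assume *: "canon_modal x y" "canon_modal y z"
  then have "deductive x" by (simp add: canon_modal_def prime_theory_deductive)
  then have "\<phi> \<in> z" if "Box \<phi> \<in> x" for \<phi>
    using * that deductive_mp_deriv[OF _ fourbox] unfolding canon_modal_def by blast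
  moreover have "Dia \<phi> \<in> x" if "\<phi> \<in> z" for \<phi>
    using * that deductive_mp_deriv[OF \<open>deductive x\<close> fourdia] unfolding canon_modal_def by blast
  ultimately show "canon_modal x z" using * unfolding canon_modal_def by blast
qed (auto simp: canon_modal_def)

text \<open>The witness extends the theory generated by \<Delta> and the formulas boxed in
  \<Gamma>'. Each \<delta> in \<Delta> has \<open>Dia \<delta>\<close> in \<Gamma> and so in
  \<Gamma>', whence \<open>kdia\<close> supplies the diamonds required.\<close>

lemma canon_forward: "forward_confluent canon_worlds canon_int canon_modal"
  unfolding forward_confluent_def
proof (intro allI impI)
  fix \<Gamma> \<Gamma>' \<Delta> assume gg: "canon_int \<Gamma> \<Gamma>'" and gd: "canon_modal \<Gamma> \<Delta>"
  have g': "deductive \<Gamma>'" and p: "prime_theory \<Gamma>'" and d: "deductive \<Delta>"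
    using gg gd by (simp_all add: canon_int_def canon_modal_def prime_theory_deductive)
  note b = deductive_Box[OF g']
  let ?\<Theta> = "{\<psi>. \<exists>\<delta>\<in>\<Delta>. Imp \<delta> \<psi> \<in> {\<chi>. Box \<chi> \<in> \<Gamma>'}}"
  have sub: "{\<chi>. Box \<chi> \<in> \<Gamma>'} \<subseteq> ?\<Theta>" "\<Delta> \<subseteq> ?\<Theta>"
    using deductive_Imp_const[OF b] deductive_Imp_refl[OF b] deductive_Imp_refl[OF d] by blast+
  obtain \<Delta>' where "canon_modal \<Gamma>' \<Delta>'" "?\<Theta> \<subseteq> \<Delta>'"
  proof (rule canon_modal_Dia_exists[OF p deductive_join[OF b d]])
    fix \<iota> assume "\<iota> \<in> ?\<Theta>"
    then obtain \<delta> where "\<delta> \<in> \<Delta>" "Box (Imp \<delta> \<iota>) \<in> \<Gamma>'" by blast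
    moreover have "Dia \<delta> \<in> \<Gamma>'"
      using \<open>\<delta> \<in> \<Delta>\<close> gg gd unfolding canon_int_def canon_modal_def by blast
    ultimately show "Dia \<iota> \<in> \<Gamma>'"
      using g' kdia deductive_mp deductive_mp_deriv by blast
  qed (use sub in auto)
  moreover from this have "canon_int \<Delta> \<Delta>'"
    using sub(2) gd unfolding canon_int_def canon_modal_def by (meson subset_trans)
  ultimately show "\<exists>v'\<in>canon_worlds. canon_int \<Delta> v' \<and> canon_modal \<Gamma>' v'"
    unfolding canon_modal_def canon_worlds_def by blast
qed

text \<open>Choosing \<open>J\<close> as the complement of \<Delta>' forces the new successor of
  \<Gamma> below \<Delta>'. Primeness of \<Delta>' makes \<open>J\<close> closed under disjunction,
  and \<open>boxdisj\<close> verifies the avoidance condition.\<close>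

lemma canon_downward: "downward_confluent canon_worlds canon_int canon_modal"
  unfolding downward_confluent_def
proof (intro allI impI)
  fix \<Gamma> \<Gamma>' \<Delta>' assume gg: "canon_int \<Gamma> \<Gamma>'" and gd: "canon_modal \<Gamma>' \<Delta>'"
  have g: "deductive \<Gamma>" and p: "prime_theory \<Gamma>" and p': "prime_theory \<Delta>'"
    using gg gd by (simp_all add: canon_int_def canon_modal_def prime_theory_deductive)
  obtain \<Delta> where "canon_modal \<Gamma> \<Delta>" "\<Delta> \<inter> - \<Delta>' = {}"
  proof (rule canon_modal_exists[OF p deductive_Box[OF g], where J = "- \<Delta>'"])
    show "- \<Delta>' \<noteq> {}" using p' by (auto simp: prime_theory_def)
    show "Disj \<phi> \<psi> \<in> - \<Delta>'" if "\<phi> \<in> - \<Delta>'" "\<psi> \<in> - \<Delta>'" for \<phi> \<psi>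
      using that p' prime_theory_Disj by blast
    fix \<kappa> \<iota> assume "Disj \<kappa> \<iota> \<in> {\<chi>. Box \<chi> \<in> \<Gamma>}" and \<kappa>: "\<kappa> \<in> - \<Delta>'"
    then have "Box \<kappa> \<in> \<Gamma> \<or> Dia \<iota> \<in> \<Gamma>"
      using deductive_mp_deriv[OF g boxdisj] prime_theory_Disj[OF p] by blast
    then show "Dia \<iota> \<in> \<Gamma>"
      using \<kappa> gg gd unfolding canon_int_def canon_modal_def by blast
  qed auto
  then show "\<exists>w'\<in>canon_worlds. canon_modal \<Gamma> w' \<and> canon_int w' \<Delta>'"
    using p' unfolding canon_int_def canon_modal_def canon_worlds_def by blast
qed

lemma canon_model: "S4I_model canon_worlds {} canon_int canon_modal canon_val"
  unfolding S4I_model_def S4I_frame_def bi_int_frame_def infallible_def valuation_def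
  using canon_preorder_int canon_preorder_modal canon_forward canon_downward
  by (auto simp: up_closed_def canon_val_def canon_int_def canon_worlds_def)

lemma canon_truth:
  "prime_theory \<Gamma> \<Longrightarrow> sat canon_worlds {} canon_int canon_modal canon_val \<Gamma> \<phi> \<longleftrightarrow> \<phi> \<in> \<Gamma>"
proof (induction \<phi> arbitrary: \<Gamma>)
  case (Var p)
  then show ?case by (simp add: canon_val_def)
next
  case Bot
  then show ?case by (simp add: prime_theory_def)
next
  case (Conj \<phi> \<psi>)
  then show ?case using deductive_Conj prime_theory_deductive by simp
next
  case (Disj \<phi> \<psi>)
  then show ?case using prime_theory_Disj by simp
next
  case (Imp \<phi> \<psi>)
  have "(\<forall>\<Delta>. canon_int \<Gamma> \<Delta> \<longrightarrow> \<phi> \<in> \<Delta> \<longrightarrow> \<psi> \<in> \<Delta>) \<longleftrightarrow> Imp \<phi> \<psi> \<in> \<Gamma>"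
    using Imp.prems canon_Imp deductive_mp prime_theory_deductive
    unfolding canon_int_def by (metis subsetD)
  then show ?case using Imp by (auto simp: canon_worlds_def canon_int_def)
next
  case (Dia \<phi>)
  have "(\<forall>\<Delta>. canon_int \<Gamma> \<Delta> \<longrightarrow> (\<exists>\<Theta>. canon_modal \<Delta> \<Theta> \<and> \<phi> \<in> \<Theta>)) \<longleftrightarrow> Dia \<phi> \<in> \<Gamma>" (is "?L \<longleftrightarrow> _")
  proof
    assume ?L
    then obtain \<Theta> where "canon_modal \<Gamma> \<Theta>" "\<phi> \<in> \<Theta>"
      using Dia.prems unfolding canon_int_def by blast
    then show "Dia \<phi> \<in> \<Gamma>" unfolding canon_modal_def by blast
  next
    assume "Dia \<phi> \<in> \<Gamma>"
    then show ?L using canon_Dia unfolding canon_int_def by (metis subsetD)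
  qed
  then show ?case using Dia.IH
    by (simp add: canon_worlds_def) (metis canon_int_def canon_modal_def)
next
  case (Box \<phi>)
  have "(\<forall>\<Delta> \<Theta>. canon_int \<Gamma> \<Delta> \<longrightarrow> canon_modal \<Delta> \<Theta> \<longrightarrow> \<phi> \<in> \<Theta>) \<longleftrightarrow> Box \<phi> \<in> \<Gamma>" (is "?L \<longleftrightarrow> _")
  proof
    assume ?L
    then show "Box \<phi> \<in> \<Gamma>"
      using Box.prems canon_Box unfolding canon_int_def by blast
  next
    assume "Box \<phi> \<in> \<Gamma>"
    then show ?L unfolding canon_int_def canon_modal_def by blast
  qed
  then show ?case using Box.IH
    by (simp add: canon_worlds_def) (metis canon_int_def canon_modal_def)
qed

theorem S4I_complete:
  assumes "\<not> S4I_deriv \<phi>"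
  shows "\<not> valid_in_model canon_worlds {} canon_int canon_modal canon_val \<phi>"
proof -
  obtain \<Gamma> where "prime_theory \<Gamma>" "\<phi> \<notin> \<Gamma>"
    using prime_theory_avoiding[OF deductive_deriv_set] assms by blast
  then show ?thesis
    using canon_truth unfolding valid_in_model_def canon_worlds_def by blast
qed

section \<open>Finite models from trees of labels\<close>

primrec subfms :: "fm \<Rightarrow> fm set" where
  "subfms (Var p) = {Var p}"
| "subfms Bot = {Bot}"
| "subfms (Conj \<phi> \<psi>) = insert (Conj \<phi> \<psi>) (subfms \<phi> \<union> subfms \<psi>)"
| "subfms (Disj \<phi> \<psi>) = insert (Disj \<phi> \<psi>) (subfms \<phi> \<union> subfms \<psi>)"
| "subfms (Imp \<phi> \<psi>) = insert (Imp \<phi> \<psi>) (subfms \<phi> \<union> subfms \<psi>)"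
| "subfms (Dia \<phi>) = insert (Dia \<phi>) (subfms \<phi>)"
| "subfms (Box \<phi>) = insert (Box \<phi>) (subfms \<phi>)"

lemma finite_subfms: "finite (subfms \<phi>)"
  by (induction \<phi>) auto

lemma subfms_refl: "\<phi> \<in> subfms \<phi>"
  by (cases \<phi>) auto

lemma subfms_trans: "\<psi> \<in> subfms \<phi> \<Longrightarrow> subfms \<psi> \<subseteq> subfms \<phi>"
  by (induction \<phi>) auto

text \<open>Children form a set, not a list, so equal subtrees under one parent merge.\<close>

datatype ltree = Node (lab: "fm set") (kids: "ltree fset")

locale S4I_filtration =
  fixes W :: "'w set" and Wb :: "'w set" and R S :: "'w \<Rightarrow> 'w \<Rightarrow> bool"
    and V :: "nat \<Rightarrow> 'w set" and \<Sigma> :: "fm set"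
  assumes model: "S4I_model W Wb R S V"
    and finite_\<Sigma>: "finite \<Sigma>"
    and subfms_\<Sigma>: "\<psi> \<in> \<Sigma> \<Longrightarrow> subfms \<psi> \<subseteq> \<Sigma>"
begin

abbreviation holds :: "'w \<Rightarrow> fm \<Rightarrow> bool" where
  "holds \<equiv> sat W Wb R S V"

lemma R_worlds: "R x y \<Longrightarrow> x \<in> W \<and> y \<in> W"
  and R_refl: "x \<in> W \<Longrightarrow> R x x"
  and R_trans: "R x y \<Longrightarrow> R y z \<Longrightarrow> R x z"
  and S_worlds: "S x y \<Longrightarrow> x \<in> W \<and> y \<in> W"
  and S_refl: "x \<in> W \<Longrightarrow> S x x"
  and S_trans: "S x y \<Longrightarrow> S y z \<Longrightarrow> S x z"
  using model unfolding S4I_model_def S4I_frame_def bi_int_frame_def preorder_on_def by metis+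

lemma Wb_empty: "Wb = {}"
  using model unfolding S4I_model_def S4I_frame_def infallible_def by blast

lemma V_up: "R x y \<Longrightarrow> x \<in> V p \<Longrightarrow> y \<in> V p"
  using model unfolding S4I_model_def valuation_def up_closed_def by blast

lemma forward: "R w w' \<Longrightarrow> S w v \<Longrightarrow> \<exists>v'. R v v' \<and> S w' v'"
  using model unfolding S4I_model_def S4I_frame_def forward_confluent_def by blast

lemma downward: "R w v \<Longrightarrow> S v v' \<Longrightarrow> \<exists>w'. S w w' \<and> R w' v'"
  using model unfolding S4I_model_def S4I_frame_def downward_confluent_def by blast

section \<open>Persistence and the modal truth conditions under confluence\<close>

lemma persistent: "R x y \<Longrightarrow> holds x \<phi> \<Longrightarrow> holds y \<phi>"
proof (induction \<phi> arbitrary: x y)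
  case (Var p)
  then show ?case using V_up by simp
next
  case Bot
  then show ?case using Wb_empty by simp
next
  case (Conj \<phi> \<psi>)
  then show ?case by auto
next
  case (Disj \<phi> \<psi>)
  then show ?case by auto
next
  case (Imp \<phi> \<psi>)
  then show ?case using R_trans unfolding sat.simps by blast
next
  case (Dia \<phi>)
  then show ?case using R_trans unfolding sat.simps by blast
next
  case (Box \<phi>)
  then show ?case using R_trans unfolding sat.simps by blast
qed

text \<open>Forward confluence carries a witness at \<open>w\<close> to every intuitionistic
  successor of \<open>w\<close>, and persistence keeps \<phi> true there.\<close>

lemma holds_Dia: "w \<in> W \<Longrightarrow> holds w (Dia \<phi>) \<longleftrightarrow> (\<exists>v. S w v \<and> holds v \<phi>)"
  using R_refl forward persistent R_worlds S_worlds by (simp, meson)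

text \<open>By downward confluence, each world reached by an intuitionistic and then a modal step
  lies intuitionistically above a modal successor of \<open>w\<close>.\<close>

lemma holds_Box: "w \<in> W \<Longrightarrow> holds w (Box \<phi>) \<longleftrightarrow> (\<forall>v. S w v \<longrightarrow> holds v \<phi>)"
  using R_refl downward persistent R_worlds S_worlds by (simp, meson)

section \<open>Labels and the trees of label-increasing chains\<close>

definition label :: "'w \<Rightarrow> fm set" where
  "label w = {\<psi> \<in> \<Sigma>. holds w \<psi>}"

lemma label_subset: "label w \<subseteq> \<Sigma>"
  by (auto simp: label_def)

lemma label_mono: "R x y \<Longrightarrow> label x \<subseteq> label y"
  using persistent by (auto simp: label_def)

lemma label_Box: "S x y \<Longrightarrow> Box \<psi> \<in> label x \<Longrightarrow> Box \<psi> \<in> label y"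
  using holds_Box S_trans S_worlds unfolding label_def by blast

lemma label_Dia: "S x y \<Longrightarrow> Dia \<psi> \<in> label y \<Longrightarrow> Dia \<psi> \<in> label x"
  using holds_Dia S_trans S_worlds unfolding label_def by blast

text \<open>The image under \<open>Abs_fset\<close> is not yet known to be finite.
  \<open>finite_trees\<close> settles this, and \<open>kids_tree\<close> then gives the usable
  description of the children.\<close>

function tree :: "'w \<Rightarrow> ltree" where
  "tree w = Node (label w) (Abs_fset (tree ` {v. R w v \<and> label w \<subset> label v}))"
  by auto
termination
proof (relation "measure (\<lambda>w. card (\<Sigma> - label w))")
  fix w v assume "v \<in> {v. R w v \<and> label w \<subset> label v}"
  then show "(v, w) \<in> measure (\<lambda>w. card (\<Sigma> - label w))"
    using label_subset[of v] finite_\<Sigma> by (auto intro!: psubset_card_mono)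
qed simp

declare tree.simps [simp del]

text \<open>Induction on the number of formulas of \<Sigma> missing from the label: a tree is fixed
  by its label and its set of subtrees, and these miss fewer formulas, so they come from a finite
  stock.\<close>

lemma finite_trees: "finite (range tree)"
proof -
  have "finite (tree ` {w. card (\<Sigma> - label w) < n})" for n
  proof (induction n)
    case (Suc n)
    let ?B = "tree ` {w. card (\<Sigma> - label w) < n}"
    have "tree ` {w. card (\<Sigma> - label w) < Suc n} \<subseteq> (\<lambda>(l, K). Node l (Abs_fset K)) ` (Pow \<Sigma> \<times> Pow ?B)"
    proof (rule image_subsetI)
      fix w assume w: "w \<in> {w. card (\<Sigma> - label w) < Suc n}"
      have "card (\<Sigma> - label v) < n" if "label w \<subset> label v" for v
      proof -
        have "card (\<Sigma> - label v) < card (\<Sigma> - label w)"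
          using that label_subset[of v] finite_\<Sigma> by (intro psubset_card_mono) auto
        then show ?thesis using w by simp
      qed
      then have "tree ` {v. R w v \<and> label w \<subset> label v} \<in> Pow ?B" by blast
      then show "tree w \<in> (\<lambda>(l, K). Node l (Abs_fset K)) ` (Pow \<Sigma> \<times> Pow ?B)"
        using label_subset[of w] by (subst tree.simps) auto
    qed
    then show ?case
      using Suc finite_\<Sigma> by (meson finite_Pow_iff finite_SigmaI finite_imageI finite_subset)
  qed simp
  \<comment> \<open>At most \<open>card \<Sigma>\<close> formulas can be missing, so this stage
    covers all worlds.\<close>
  from this[of "Suc (card \<Sigma>)"] show ?thesis
    using finite_\<Sigma> by (simp add: less_Suc_eq_le card_mono)
qed

lemma lab_tree [simp]: "lab (tree w) = label w"
  by (subst tree.simps) simp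

lemma kids_tree: "C |\<in>| kids (tree w) \<longleftrightarrow> (\<exists>v. R w v \<and> label w \<subset> label v \<and> C = tree v)"
proof -
  have "finite (tree ` {v. R w v \<and> label w \<subset> label v})"
    using finite_trees by (rule rev_finite_subset) blast
  then show ?thesis by (subst tree.simps) (auto simp: Abs_fset_inverse)
qed

text \<open>A world of the finite model is a node of some \<^term>\<open>tree w\<close>, given by the path that leads to it
  from the root. Paths are stored in reverse, so the current subtree is the head, the root
  is the last entry, and the tree order is \<^const>\<open>suffix\<close>.\<close>

inductive_set paths :: "ltree list set" where
  root: "w \<in> W \<Longrightarrow> [tree w] \<in> paths"
| step: "p \<in> paths \<Longrightarrow> C |\<in>| kids (hd p) \<Longrightarrow> C # p \<in> paths"

lemma paths_nonempty [simp]: "[] \<notin> paths"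
  by (auto elim: paths.cases)

lemma paths_ConsD: "C # p \<in> paths \<Longrightarrow> p \<noteq> [] \<Longrightarrow> p \<in> paths \<and> C |\<in>| kids (hd p)"
  by (auto elim: paths.cases)

lemma paths_hd: "p \<in> paths \<Longrightarrow> \<exists>w\<in>W. hd p = tree w"
proof (induction rule: paths.induct)
  case (step p C)
  then show ?case using R_worlds kids_tree by (metis list.sel(1))
qed auto

lemma paths_last: "p \<in> paths \<Longrightarrow> \<exists>w\<in>W. last p = tree w"
  by (induction rule: paths.induct) (auto split: if_splits)

lemma paths_kid_lab: "p \<in> paths \<Longrightarrow> C |\<in>| kids (hd p) \<Longrightarrow> lab (hd p) \<subset> lab C"
  using paths_hd kids_tree by fastforce

lemma paths_suffix: "suffix p q \<Longrightarrow> q \<in> paths \<Longrightarrow> p \<noteq> [] \<Longrightarrow> p \<in> paths"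
  by (induction q) (auto simp: suffix_Cons dest: paths_ConsD)

lemma paths_lab_mono: "q \<in> paths \<Longrightarrow> p \<noteq> [] \<Longrightarrow> suffix p q \<Longrightarrow> lab (hd p) \<subseteq> lab (hd q)"
proof (induction rule: paths.induct)
  case (step q C)
  then show ?case using paths_kid_lab by (auto simp: suffix_Cons)
qed (auto simp: suffix_Cons)

text \<open>Labels grow strictly along a path, so its entries are distinct trees from a finite set.
  The label clause of the invariant shows that a new head is fresh.\<close>

lemma finite_paths: "finite paths"
proof -
  have "distinct p \<and> set p \<subseteq> range tree \<and> (\<forall>C\<in>set p. lab C \<subseteq> lab (hd p))" if "p \<in> paths" for p
    using that
  proof (induction rule: paths.induct)
    case (step p C)
    then have "lab (hd p) \<subset> lab C" "\<forall>D\<in>set p. lab D \<subseteq> lab (hd p)"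
      using paths_kid_lab by blast+
    then have "C \<notin> set p" "\<forall>D\<in>set p. lab D \<subseteq> lab C" by auto
    moreover have "C \<in> range tree"
      using step paths_hd kids_tree by (metis rangeI)
    ultimately show ?case using step by auto
  qed simp
  then have "paths \<subseteq> {p. set p \<subseteq> range tree \<and> distinct p}" by blast
  then show ?thesis using finite_subset finite_subset_distinct[OF finite_trees] by blast
qed

section \<open>The finite frame of paths and its valuation\<close>

definition path_int :: "ltree list \<Rightarrow> ltree list \<Rightarrow> bool" where
  "path_int p q \<longleftrightarrow> p \<in> paths \<and> q \<in> paths \<and> suffix p q"

text \<open>Boxes are compared with boxes and diamonds with diamonds, as in a transitive filtration,
  so the relation composes. Reflexivity of \<open>S\<close> recovers the unboxed form in the truth
  lemma.\<close>

definition sensible :: "ltree list \<Rightarrow> ltree list \<Rightarrow> bool" where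
  "sensible p q \<longleftrightarrow> (\<forall>\<psi>. Box \<psi> \<in> lab (hd p) \<longrightarrow> Box \<psi> \<in> lab (hd q)) \<and>
     (\<forall>\<psi>. Dia \<psi> \<in> lab (hd q) \<longrightarrow> Dia \<psi> \<in> lab (hd p))"

definition transfer :: "(ltree list \<Rightarrow> ltree list) \<Rightarrow> bool" where
  "transfer g \<longleftrightarrow> (\<forall>p\<in>paths. g p \<in> paths \<and> sensible p (g p)) \<and>
     (\<forall>p\<in>paths. \<forall>q\<in>paths. suffix p q \<longrightarrow> suffix (g p) (g q))"

text \<open>Moving whole trees by monotone maps makes both confluence conditions automatic.\<close>

definition path_modal :: "ltree list \<Rightarrow> ltree list \<Rightarrow> bool" where
  "path_modal p q \<longleftrightarrow> p \<in> paths \<and> (\<exists>g. transfer g \<and> q = g p)"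

definition path_val :: "nat \<Rightarrow> ltree list set" where
  "path_val n = {p \<in> paths. Var n \<in> lab (hd p)}"

lemma path_modalD: "path_modal p q \<Longrightarrow> p \<in> paths \<and> q \<in> paths \<and> sensible p q"
  unfolding path_modal_def transfer_def by blast

lemma path_int_lab: "path_int p q \<Longrightarrow> lab (hd p) \<subseteq> lab (hd q)"
  unfolding path_int_def using paths_lab_mono paths_nonempty by metis

lemma path_modal_refl: "p \<in> paths \<Longrightarrow> path_modal p p"
  unfolding path_modal_def transfer_def sensible_def by (intro conjI exI[of _ "\<lambda>x. x"]) auto

lemma path_modal_trans: "path_modal p q \<Longrightarrow> path_modal q r \<Longrightarrow> path_modal p r"
proof -
  assume "path_modal p q" "path_modal q r"
  then obtain g h where *: "p \<in> paths" "transfer g" "q = g p" "transfer h" "r = h q"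
    unfolding path_modal_def by blast
  have "sensible x (h (g x))" if "x \<in> paths" for x
    using *(2,4) that unfolding transfer_def sensible_def by blast
  then have "transfer (\<lambda>x. h (g x))"
    using *(2,4) unfolding transfer_def by simp
  then show ?thesis using * unfolding path_modal_def by blast
qed

lemma path_frame: "S4I_frame paths {} path_int path_modal"
  unfolding S4I_frame_def bi_int_frame_def infallible_def
proof (intro conjI)
  show "preorder_on paths path_int"
    unfolding preorder_on_def path_int_def using suffix_order.trans by blast
  show "preorder_on paths path_modal"
    unfolding preorder_on_def using path_modalD path_modal_refl path_modal_trans by blast
  \<comment> \<open>If \<open>g\<close> maps \<open>w\<close> to \<open>v\<close>, the forward
    witness is \<open>g w'\<close>; in the downward case, if \<open>g\<close> maps \<open>v\<close>
    to \<open>v'\<close>, it is \<open>g w\<close>.\<close>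
  show "forward_confluent paths path_int path_modal"
    unfolding forward_confluent_def path_int_def path_modal_def transfer_def by blast
  show "downward_confluent paths path_int path_modal"
    unfolding downward_confluent_def path_int_def path_modal_def transfer_def by blast
qed (auto simp: up_closed_def)

lemma path_model: "S4I_model paths {} path_int path_modal path_val"
  unfolding S4I_model_def valuation_def up_closed_def
  using path_frame path_int_lab by (auto simp: path_val_def path_int_def)

section \<open>Realising a tree by worlds and moving it along a modal step\<close>

primrec lift :: "'w \<Rightarrow> ltree list \<Rightarrow> 'w" where
  "lift w [] = w"
| "lift w (C # p) = (if p = [] then w else SOME v. R (lift w p) v \<and> C = tree v)"

text \<open>A path records trees, not worlds. Choosing worlds outwards from the root
  \<open>w\<close> places each one intuitionistically above the world chosen for its parent.\<close>

lemma lift_path: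
  "p \<in> paths \<Longrightarrow> w \<in> W \<Longrightarrow> last p = tree w \<Longrightarrow> lift w p \<in> W \<and> hd p = tree (lift w p) \<and>
     (tl p \<noteq> [] \<longrightarrow> R (lift w (tl p)) (lift w p))"
proof (induction rule: paths.induct)
  case (step p C)
  have "p \<noteq> []" using step by auto
  then have "hd p = tree (lift w p)" using step by simp
  then obtain v where "R (lift w p) v \<and> C = tree v" using step kids_tree by auto
  then have "R (lift w p) (SOME v. R (lift w p) v \<and> C = tree v) \<and>
      C = tree (SOME v. R (lift w p) v \<and> C = tree v)"
    by (rule someI)
  then have "R (lift w p) (lift w (C # p)) \<and> C = tree (lift w (C # p))"
    using \<open>p \<noteq> []\<close> by simp
  then show ?case using R_worlds by auto
qed auto

text \<open>Induction from \<open>q\<close> towards the root: downward confluence turns the target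
  \<open>v\<close> of a node into a target \<open>u\<close> for its parent, to which the induction
  hypothesis applies.\<close>

lemma extend_down:
  assumes "\<And>C p. suffix (C # p) q \<Longrightarrow> p \<noteq> [] \<Longrightarrow> R (f p) (f (C # p))" "S (f q) v" "q \<noteq> []"
  shows "\<exists>h. h q = v \<and> (\<forall>p. suffix p q \<longrightarrow> p \<noteq> [] \<longrightarrow> S (f p) (h p)) \<and>
     (\<forall>C p. suffix (C # p) q \<longrightarrow> p \<noteq> [] \<longrightarrow> R (h p) (h (C # p)))"
  using assms
proof (induction q arbitrary: v)
  case (Cons C q)
  show ?case
  proof (cases "q = []")
    case True
    then show ?thesis using Cons.prems by (intro exI[of _ "\<lambda>_. v"]) (auto simp: suffix_Cons)
  next
    case False
    then have "R (f q) (f (C # q))" using Cons.prems(1) by blast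
    then obtain u where u: "S (f q) u" "R u v" using downward Cons.prems(2) by blast
    obtain h where h: "h q = u" "\<And>p. suffix p q \<Longrightarrow> p \<noteq> [] \<Longrightarrow> S (f p) (h p)"
      "\<And>C p. suffix (C # p) q \<Longrightarrow> p \<noteq> [] \<Longrightarrow> R (h p) (h (C # p))"
      using Cons.IH[OF _ u(1) False] Cons.prems(1) by (metis suffix_ConsI)
    \<comment> \<open>Only the value at \<open>C # q\<close> is reassigned below; it is no suffix of
      \<open>q\<close>, so the rest of the branch keeps its values.\<close>
    have neq: "p \<noteq> C # q" if "suffix p q" for p
      using that by (auto simp: suffix_def)
    have "\<not> suffix (C # q) q" by (auto simp: suffix_def)
    then show ?thesis
      using h u Cons.prems neq
      by (intro exI[of _ "h(C # q := v)"]) (auto simp: suffix_Cons dest: suffix_ConsD)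
  qed
qed simp

text \<open>The branch from the root to \<open>q\<close> is moved by \<open>extend_down\<close>;
  every node off it gets its image from that of its parent by forward confluence.\<close>

lemma extend_tree:
  assumes f: "\<And>C p. C # p \<in> paths \<Longrightarrow> p \<noteq> [] \<Longrightarrow> last p = T \<Longrightarrow> R (f p) (f (C # p))"
    and q: "q \<in> paths" "last q = T" "S (f q) v"
  shows "\<exists>g. g q = v \<and> (\<forall>p\<in>paths. last p = T \<longrightarrow> S (f p) (g p)) \<and>
     (\<forall>C p. C # p \<in> paths \<longrightarrow> p \<noteq> [] \<longrightarrow> last p = T \<longrightarrow> R (g p) (g (C # p)))"
proof -
  have "q \<noteq> []" using q by auto
  have fq: "R (f p) (f (C # p))" if "suffix (C # p) q" "p \<noteq> []" for C p
    using that f q paths_suffix by (metis last_ConsR last_appendR list.discI suffixE)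
  obtain h where h: "h q = v" "\<And>p. suffix p q \<Longrightarrow> p \<noteq> [] \<Longrightarrow> S (f p) (h p)"
      "\<And>C p. suffix (C # p) q \<Longrightarrow> p \<noteq> [] \<Longrightarrow> R (h p) (h (C # p))"
    using extend_down[OF fq q(3) \<open>q \<noteq> []\<close>] by metis
  \<comment> \<open>Here \<open>u\<close> is the value already computed at \<open>p\<close>. The
    value \<open>v\<close> at the empty list is a dummy: the root \<open>[T]\<close> lies on the
    branch, so its image is given by \<open>h\<close>.\<close>
  define g where "g = rec_list v (\<lambda>C p u. if suffix (C # p) q then h (C # p)
     else (SOME v'. R u v' \<and> S (f (C # p)) v'))"
  have g_suffix: "g p = h p" if "suffix p q" "p \<noteq> []" for p
    using that by (cases p) (auto simp: g_def)
  have g_other: "g (C # p) = (SOME v'. R (g p) v' \<and> S (f (C # p)) v')" if "\<not> suffix (C # p) q" for C p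
    using that by (simp add: g_def)
  have last_suffix: "suffix [T] q" using q(2) \<open>q \<noteq> []\<close>
    by (metis append_butlast_last_id suffixI)
  have "S (f p) (g p) \<and> (tl p \<noteq> [] \<longrightarrow> R (g (tl p)) (g p))" if "p \<in> paths" "last p = T" for p
    using that
  proof (induction rule: paths.induct)
    case (root w)
    then show ?case using g_suffix h(2) last_suffix by simp
  next
    case (step p C)
    have "p \<noteq> []" using step by auto
    then have IH: "S (f p) (g p)" and T: "last p = T" using step by auto
    show ?case
    proof (cases "suffix (C # p) q")
      case True
      moreover have "suffix p q" using True by (rule suffix_ConsD)
      ultimately show ?thesis using g_suffix h(2,3) \<open>p \<noteq> []\<close> by simp
    next
      case False
      have "R (f p) (f (C # p))" using f step paths.step \<open>p \<noteq> []\<close> T by blast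
      then have "\<exists>v'. R (g p) v' \<and> S (f (C # p)) v'" using forward IH by blast
      then have "R (g p) (g (C # p)) \<and> S (f (C # p)) (g (C # p))"
        unfolding g_other[OF False] by (rule someI_ex)
      then show ?thesis by simp
    qed
  qed
  moreover have "g q = v" using g_suffix[of q] \<open>q \<noteq> []\<close> h(1) by simp
  ultimately show ?thesis by (intro exI[of _ g]) force
qed

primrec squash :: "(ltree list \<Rightarrow> 'w) \<Rightarrow> ltree list \<Rightarrow> ltree list" where
  "squash g [] = []"
| "squash g (C # p) =
     (if p \<noteq> [] \<and> label (g (C # p)) = label (g p) then squash g p else tree (g (C # p)) # squash g p)"

lemma squash_suffix: "suffix p q \<Longrightarrow> suffix (squash g p) (squash g q)"
proof (induction q)
  case (Cons C q)
  then consider "p = C # q" | "suffix p q" by (auto simp: suffix_Cons)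
  then show ?case
    by cases (use Cons.IH in \<open>auto intro: suffix_ConsI\<close>)
qed simp

text \<open>The head of the squashed path is the tree of the last world \<open>u\<close> at which
  the label changed, so \<open>u\<close> may lie below \<open>g p\<close> but shares its label. At
  the next strict increase, the new world is above \<open>u\<close> and thus yields a child of
  \<open>tree u\<close>.\<close>

lemma squash_path:
  assumes "\<And>p. p \<in> paths \<Longrightarrow> last p = T \<Longrightarrow> g p \<in> W"
    and "\<And>C p. C # p \<in> paths \<Longrightarrow> p \<noteq> [] \<Longrightarrow> last p = T \<Longrightarrow> R (g p) (g (C # p))"
    and "p \<in> paths" "last p = T"
  shows "squash g p \<in> paths \<and> (\<exists>u. hd (squash g p) = tree u \<and> R u (g p) \<and> label u = label (g p))"
  using assms(3,4)
proof (induction rule: paths.induct)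
  case (root w)
  then have "g [tree w] \<in> W" using assms(1)[OF paths.root] by simp
  then show ?case using paths.root R_refl by auto
next
  case (step p C)
  have "p \<noteq> []" using step by auto
  then have T: "last p = T" using step by simp
  have path: "C # p \<in> paths" using step paths.step by blast
  have R: "R (g p) (g (C # p))" using assms(2) path \<open>p \<noteq> []\<close> T by blast
  obtain u where u: "squash g p \<in> paths" "hd (squash g p) = tree u" "R u (g p)" "label u = label (g p)"
    using step T by blast
  have Ru: "R u (g (C # p))" using R u R_trans by blast
  show ?case
  proof (cases "label (g (C # p)) = label (g p)")
    case True
    then show ?thesis using u Ru \<open>p \<noteq> []\<close> by auto
  next
    case False
    then have "tree (g (C # p)) |\<in>| kids (hd (squash g p))"
      using u(2,4) Ru label_mono[OF R] kids_tree by auto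
    then have "tree (g (C # p)) # squash g p \<in> paths" using u paths.step by blast
    then show ?thesis using False R_refl R R_worlds by auto
  qed
qed

text \<open>The existence property behind both modal cases of the truth lemma. Here \<open>u\<close>
  is the world that \<open>lift\<close> assigns to \<open>q\<close>, so a modal step from
  \<open>u\<close> extends to the whole tree containing \<open>q\<close>.\<close>

lemma path_modal_exists:
  assumes "q \<in> paths"
  obtains u where "u \<in> W" "label u = lab (hd q)" "\<And>v. S u v \<Longrightarrow> \<exists>r. path_modal q r \<and> lab (hd r) = label v"
proof -
  obtain w where w: "w \<in> W" "last q = tree w" using paths_last assms by blast
  define f where "f = lift w"
  let ?T = "tree w"
  have f: "f p \<in> W" "hd p = tree (f p)" if "p \<in> paths" "last p = ?T" for p
    using lift_path[of p w] that w by (auto simp: f_def)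
  have fR: "R (f p) (f (C # p))" if "C # p \<in> paths" "p \<noteq> []" "last p = ?T" for C p
    using lift_path[of "C # p" w] that w by (auto simp: f_def)
  have "\<exists>r. path_modal q r \<and> lab (hd r) = label v" if Sv: "S (f q) v" for v
  proof -
    obtain g where g': "g q = v \<and> (\<forall>p\<in>paths. last p = ?T \<longrightarrow> S (f p) (g p)) \<and>
      (\<forall>C p. C # p \<in> paths \<longrightarrow> p \<noteq> [] \<longrightarrow> last p = ?T \<longrightarrow> R (g p) (g (C # p)))"
      using extend_tree[OF fR assms w(2) Sv] by (rule exE)
    then have g: "g q = v" "\<And>p. p \<in> paths \<Longrightarrow> last p = ?T \<Longrightarrow> S (f p) (g p)"
      "\<And>C p. C # p \<in> paths \<Longrightarrow> p \<noteq> [] \<Longrightarrow> last p = ?T \<Longrightarrow> R (g p) (g (C # p))"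
      by simp_all
    have gW: "g p \<in> W" if "p \<in> paths" "last p = ?T" for p
      using g(2)[OF that] S_worlds by blast
    have sq: "squash g p \<in> paths" "lab (hd (squash g p)) = label (g p)"
      if p: "p \<in> paths" "last p = ?T" for p
    proof -
      have "squash g p \<in> paths \<and> (\<exists>u. hd (squash g p) = tree u \<and> R u (g p) \<and> label u = label (g p))"
        by (rule squash_path[of ?T]) (fact gW g(3) p)+
      then obtain u where "squash g p \<in> paths" "hd (squash g p) = tree u" "label u = label (g p)"
        by (elim conjE exE)
      then show "squash g p \<in> paths" "lab (hd (squash g p)) = label (g p)"
        by (simp_all only: lab_tree)
    qed
    \<comment> \<open>A transfer must act on all paths: the tree with root \<open>?T\<close> is
      moved and every other tree stays fixed. Monotonicity survives because a suffix of a path has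
      the same root.\<close>
    define G where "G p = (if last p = ?T then squash g p else p)" for p
    have G_T: "G p = squash g p" if "last p = ?T" for p using that by (simp add: G_def)
    have G_other: "G p = p" if "last p \<noteq> ?T" for p using that by (simp add: G_def)
    have "transfer G"
      unfolding transfer_def
    proof (intro conjI ballI impI)
      fix p assume p: "p \<in> paths"
      show "G p \<in> paths"
        using p sq(1)[OF p] G_T[of p] G_other[of p] by (cases "last p = ?T") simp_all
      show "sensible p (G p)"
      proof (cases "last p = ?T")
        case True
        then have "lab (hd p) = label (f p)" "S (f p) (g p)"
          using f(2)[OF p True] g(2)[OF p True] by simp_all
        moreover have "lab (hd (G p)) = label (g p)"
          using sq(2)[OF p True] G_T[OF True] by simp
        ultimately show ?thesis unfolding sensible_def using label_Box label_Dia by metis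
      qed (simp add: G_other sensible_def)
    next
      fix p p' assume "p \<in> paths" "p' \<in> paths" "suffix p p'"
      moreover have "last p = last p'"
        using \<open>p \<in> paths\<close> \<open>suffix p p'\<close> by (metis last_appendR paths_nonempty suffixE)
      ultimately show "suffix (G p) (G p')" using squash_suffix by (simp add: G_def)
    qed
    then have "path_modal q (G q)" using assms unfolding path_modal_def by blast
    moreover have "lab (hd (G q)) = label v"
      using sq(2)[OF assms w(2)] G_T[OF w(2)] g(1) by simp
    ultimately show ?thesis by blast
  qed
  then show thesis using that[of "f q"] f[OF assms w(2)] by simp
qed

text \<open>Implication uses that every larger label above a world occurs at a child.
  \<open>path_modal_exists\<close> provides the successors for \<open>Dia\<close> and the
  refutations for \<open>Box\<close>; the converses follow from \<open>sensible\<close> and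
  reflexivity of \<open>S\<close>.\<close>

lemma path_truth:
  "\<phi> \<in> \<Sigma> \<Longrightarrow> p \<in> paths \<Longrightarrow> sat paths {} path_int path_modal path_val p \<phi> \<longleftrightarrow> \<phi> \<in> lab (hd p)"
proof (induction \<phi> arbitrary: p)
  case (Var n)
  then show ?case by (simp add: path_val_def)
next
  case Bot
  then obtain w where "w \<in> W" "hd p = tree w" using paths_hd by blast
  moreover have "Bot \<notin> label w" using Wb_empty unfolding label_def by simp
  ultimately show ?case by simp
next
  case (Conj \<phi> \<psi>)
  then have "\<phi> \<in> \<Sigma>" "\<psi> \<in> \<Sigma>"
    using subfms_\<Sigma>[OF Conj.prems(1)] subfms_refl[of \<phi>] subfms_refl[of \<psi>] by auto
  moreover obtain w where "w \<in> W" "hd p = tree w" using paths_hd Conj.prems by blast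
  ultimately show ?case using Conj by (simp add: label_def)
next
  case (Disj \<phi> \<psi>)
  then have "\<phi> \<in> \<Sigma>" "\<psi> \<in> \<Sigma>"
    using subfms_\<Sigma>[OF Disj.prems(1)] subfms_refl[of \<phi>] subfms_refl[of \<psi>] by auto
  moreover obtain w where "w \<in> W" "hd p = tree w" using paths_hd Disj.prems by blast
  ultimately show ?case using Disj by (simp add: label_def)
next
  case (Imp \<phi> \<psi>)
  have sub: "\<phi> \<in> \<Sigma>" "\<psi> \<in> \<Sigma>"
    using subfms_\<Sigma>[OF Imp.prems(1)] subfms_refl[of \<phi>] subfms_refl[of \<psi>] by auto
  have "(\<forall>q. path_int p q \<longrightarrow> \<phi> \<in> lab (hd q) \<longrightarrow> \<psi> \<in> lab (hd q)) \<longleftrightarrow> Imp \<phi> \<psi> \<in> lab (hd p)"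
    (is "?L \<longleftrightarrow> _")
  proof
    assume L: ?L
    obtain w where w: "w \<in> W" "hd p = tree w" using paths_hd Imp.prems by blast
    have "holds v \<psi>" if v: "R w v" "holds v \<phi>" for v
    proof -
      \<comment> \<open>A world above \<open>w\<close> with the same label is represented by
        \<open>p\<close> itself, any other by a child of \<open>p\<close>.\<close>
      obtain q where "path_int p q" "lab (hd q) = label v"
      proof (cases "label v = label w")
        case True
        then show ?thesis using that[of p] w Imp.prems by (auto simp: path_int_def)
      next
        case False
        then have "label w \<subset> label v" using label_mono[OF v(1)] by blast
        then have "tree v |\<in>| kids (hd p)" using w v kids_tree by auto
        then have "tree v # p \<in> paths" using paths.step Imp.prems by blast
        then show ?thesis using that[of "tree v # p"] Imp.prems by (auto simp: path_int_def suffix_ConsI)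
      qed
      then show ?thesis using L v sub by (auto simp: label_def)
    qed
    then show "Imp \<phi> \<psi> \<in> lab (hd p)" using w Imp.prems by (simp add: label_def)
  next
    assume "Imp \<phi> \<psi> \<in> lab (hd p)"
    moreover have "\<psi> \<in> lab (hd q)" if q: "q \<in> paths" "Imp \<phi> \<psi> \<in> lab (hd q)" "\<phi> \<in> lab (hd q)" for q
    proof -
      obtain w where "w \<in> W" "hd q = tree w" using paths_hd q by blast
      then show ?thesis using q sub R_refl by (auto simp: label_def)
    qed
    ultimately show ?L using path_int_lab unfolding path_int_def by blast
  qed
  then show ?case using Imp sub by (auto simp: path_int_def)
next
  case (Dia \<phi>)
  have sub: "\<phi> \<in> \<Sigma>"
    using subfms_\<Sigma>[OF Dia.prems(1)] subfms_refl[of \<phi>] by auto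
  have "(\<forall>q. path_int p q \<longrightarrow> (\<exists>r. path_modal q r \<and> \<phi> \<in> lab (hd r))) \<longleftrightarrow> Dia \<phi> \<in> lab (hd p)"
    (is "?L \<longleftrightarrow> _")
  proof
    assume ?L
    moreover have "path_int p p" using Dia.prems by (simp add: path_int_def)
    ultimately obtain r where r: "path_modal p r" "\<phi> \<in> lab (hd r)" by blast
    obtain v where v: "v \<in> W" "hd r = tree v" using r paths_hd path_modalD by blast
    then have "holds v \<phi>" using r(2) by (simp add: label_def)
    \<comment> \<open>Only formulas of the form \<open>Dia \<phi>\<close> travel backwards along
      \<open>path_modal\<close>, so \<phi> is first strengthened to \<open>Dia \<phi>\<close> at
      \<open>r\<close> by reflexivity.\<close>
    then have "holds v (Dia \<phi>)" using holds_Dia[OF v(1)] S_refl[OF v(1)] by blast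
    then have "Dia \<phi> \<in> lab (hd r)" using v(2) Dia.prems by (simp add: label_def del: sat.simps)
    then show "Dia \<phi> \<in> lab (hd p)" using path_modalD[OF r(1)] by (simp add: sensible_def)
  next
    assume dia: "Dia \<phi> \<in> lab (hd p)"
    show ?L
    proof (intro allI impI)
      fix q assume "path_int p q"
      then have q: "q \<in> paths" "Dia \<phi> \<in> lab (hd q)"
        using dia path_int_lab unfolding path_int_def by blast+
      obtain u where u: "u \<in> W" "label u = lab (hd q)"
        "\<And>v. S u v \<Longrightarrow> \<exists>r. path_modal q r \<and> lab (hd r) = label v"
        using path_modal_exists q by blast
      then have "Dia \<phi> \<in> label u" using q by simp
      then have "holds u (Dia \<phi>)" unfolding label_def by blast
      then obtain v where "S u v" "holds v \<phi>" using u(1) holds_Dia by blast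
      then have "\<phi> \<in> label v" using sub by (simp add: label_def)
      then show "\<exists>r. path_modal q r \<and> \<phi> \<in> lab (hd r)" using u(3)[OF \<open>S u v\<close>] by blast
    qed
  qed
  then show ?case using Dia.IH[OF sub]
    by simp (metis path_int_def path_modalD)
next
  case (Box \<phi>)
  have sub: "\<phi> \<in> \<Sigma>"
    using subfms_\<Sigma>[OF Box.prems(1)] subfms_refl[of \<phi>] by auto
  have "(\<forall>q r. path_int p q \<longrightarrow> path_modal q r \<longrightarrow> \<phi> \<in> lab (hd r)) \<longleftrightarrow> Box \<phi> \<in> lab (hd p)"
    (is "?L \<longleftrightarrow> _")
  proof
    assume L: ?L
    obtain u where u: "u \<in> W" "label u = lab (hd p)"
      "\<And>v. S u v \<Longrightarrow> \<exists>r. path_modal p r \<and> lab (hd r) = label v"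
      using path_modal_exists Box.prems by blast
    have "holds v \<phi>" if "S u v" for v
    proof -
      obtain r where "path_modal p r" "lab (hd r) = label v" using u(3)[OF \<open>S u v\<close>] by blast
      moreover have "path_int p p" using Box.prems by (simp add: path_int_def)
      ultimately have "\<phi> \<in> label v" using L by blast
      then show ?thesis by (simp add: label_def)
    qed
    then have "holds u (Box \<phi>)" using u(1) holds_Box by blast
    then have "Box \<phi> \<in> label u" using Box.prems by (simp add: label_def del: sat.simps)
    then show "Box \<phi> \<in> lab (hd p)" using u(2) by simp
  next
    assume "Box \<phi> \<in> lab (hd p)"
    moreover have "\<phi> \<in> lab (hd r)" if r: "r \<in> paths" "Box \<phi> \<in> lab (hd r)" for r
    proof -
      obtain v where v: "v \<in> W" "hd r = tree v" using r paths_hd by blast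
      then have "holds v (Box \<phi>)" using r(2) by (simp add: label_def del: sat.simps)
      then have "holds v \<phi>" using holds_Box[OF v(1)] S_refl[OF v(1)] by blast
      then show ?thesis using v(2) sub by (simp add: label_def)
    qed
    ultimately show ?L using path_int_lab path_modalD unfolding sensible_def by blast
  qed
  then show ?case using Box.IH[OF sub]
    by simp (metis path_int_def path_modalD)
qed

end

theorem S4I_finite_path_model:
  fixes W :: "'w set"
  assumes "S4I_model W Wb R S V" "\<not> valid_in_model W Wb R S V \<phi>"
  shows "\<exists>(P :: ltree list set) R' S' V'. finite P \<and> S4I_model P {} R' S' V' \<and>
    \<not> valid_in_model P {} R' S' V' \<phi>"
proof -
  interpret S4I_filtration W Wb R S V "subfms \<phi>"
    by unfold_locales (use assms finite_subfms subfms_trans in auto)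
  obtain w where w: "w \<in> W" "\<not> sat W Wb R S V w \<phi>"
    using assms(2) unfolding valid_in_model_def by blast
  \<comment> \<open>The refuting world is represented by the root of its own tree.\<close>
  then have "\<not> sat paths {} path_int path_modal path_val [tree w] \<phi>"
    using path_truth[OF subfms_refl paths.root[OF w(1)]] by (simp add: label_def)
  then have "\<not> valid_in_model paths {} path_int path_modal path_val \<phi>"
    using paths.root[OF w(1)] unfolding valid_in_model_def by blast
  then show ?thesis using finite_paths path_model by blast
qed

section \<open>Renaming worlds\<close>

context
  fixes f :: "'w \<Rightarrow> 'v" and W Wb :: "'w set" and R S :: "'w \<Rightarrow> 'w \<Rightarrow> bool" and V :: "nat \<Rightarrow> 'w set"
  assumes inj: "inj_on f W" and model: "S4I_model W Wb R S V"
begin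

text \<open>Witnesses are restricted to \<open>W\<close> because \<open>f\<close> is injective only
  there.\<close>

definition image_rel :: "('w \<Rightarrow> 'w \<Rightarrow> bool) \<Rightarrow> 'v \<Rightarrow> 'v \<Rightarrow> bool" where
  "image_rel Q a b \<longleftrightarrow> (\<exists>x\<in>W. \<exists>y\<in>W. a = f x \<and> b = f y \<and> Q x y)"

lemma image_rel_iff: "x \<in> W \<Longrightarrow> y \<in> W \<Longrightarrow> image_rel Q (f x) (f y) \<longleftrightarrow> Q x y"
  using inj unfolding image_rel_def inj_on_def by blast

lemma image_rel_preorder:
  assumes "preorder_on W Q" shows "preorder_on (f ` W) (image_rel Q)"
  unfolding preorder_on_def
proof (intro conjI allI impI)
  fix a b c assume "image_rel Q a b" "image_rel Q b c"
  then obtain x y z where "a = f x" "b = f y" "c = f z" "x \<in> W" "y \<in> W" "z \<in> W" "Q x y" "Q y z"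
    using image_rel_iff unfolding image_rel_def by metis
  then show "image_rel Q a c" using assms unfolding preorder_on_def image_rel_def by blast
next
  show "\<forall>a\<in>f ` W. image_rel Q a a"
    using assms unfolding preorder_on_def image_rel_def by blast
qed (auto simp: image_rel_def)

lemma image_up_closed:
  assumes "up_closed W Q A" shows "up_closed (f ` W) (image_rel Q) (f ` A)"
  using assms inj unfolding up_closed_def image_rel_def inj_on_def by blast

lemma image_model: "S4I_model (f ` W) (f ` Wb) (image_rel R) (image_rel S) (\<lambda>p. f ` V p)"
proof -
  have fr: "preorder_on W R" "preorder_on W S" "up_closed W R Wb" "up_closed W S Wb" "Wb = {}"
    "forward_confluent W R S" "downward_confluent W R S"
    "\<And>p. up_closed W R (V p)" "\<And>p. Wb \<subseteq> V p"
    using model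
    unfolding S4I_model_def S4I_frame_def bi_int_frame_def infallible_def valuation_def by auto
  have "forward_confluent (f ` W) (image_rel R) (image_rel S)"
    unfolding forward_confluent_def
  proof (intro allI impI)
    fix a a' b assume "image_rel R a a'" "image_rel S a b"
    then obtain x x' y where *: "a = f x" "a' = f x'" "b = f y" "x \<in> W" "x' \<in> W" "y \<in> W" "R x x'" "S x y"
      using image_rel_iff unfolding image_rel_def by metis
    then obtain y' where "y' \<in> W" "R y y'" "S x' y'"
      using fr(6) unfolding forward_confluent_def by blast
    then show "\<exists>v'\<in>f ` W. image_rel R b v' \<and> image_rel S a' v'"
      using * unfolding image_rel_def by blast
  qed
  moreover have "downward_confluent (f ` W) (image_rel R) (image_rel S)"
    unfolding downward_confluent_def
  proof (intro allI impI)
    fix a b b' assume "image_rel R a b" "image_rel S b b'"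
    then obtain x y y' where *: "a = f x" "b = f y" "b' = f y'" "x \<in> W" "y \<in> W" "y' \<in> W" "R x y" "S y y'"
      using image_rel_iff unfolding image_rel_def by metis
    then obtain x' where "x' \<in> W" "S x x'" "R x' y'"
      using fr(7) unfolding downward_confluent_def by blast
    then show "\<exists>w'\<in>f ` W. image_rel S a w' \<and> image_rel R w' b'"
      using * unfolding image_rel_def by blast
  qed
  ultimately show ?thesis
    unfolding S4I_model_def S4I_frame_def bi_int_frame_def infallible_def valuation_def
    using fr(1,2,5,9) image_rel_preorder image_up_closed[OF fr(3)] image_up_closed[OF fr(4)]
      image_up_closed[OF fr(8)] by auto
qed

lemma image_sat:
  "x \<in> W \<Longrightarrow> sat (f ` W) (f ` Wb) (image_rel R) (image_rel S) (\<lambda>p. f ` V p) (f x) \<phi>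
     \<longleftrightarrow> sat W Wb R S V x \<phi>"
proof (induction \<phi> arbitrary: x)
  case (Var p)
  have "V p \<subseteq> W" using model unfolding S4I_model_def valuation_def up_closed_def by blast
  then show ?case using Var inj by (simp add: inj_on_image_mem_iff)
next
  case Bot
  then show ?case using model unfolding S4I_model_def S4I_frame_def infallible_def by simp
qed (simp_all add: image_rel_iff)

lemma image_valid:
  "valid_in_model (f ` W) (f ` Wb) (image_rel R) (image_rel S) (\<lambda>p. f ` V p) \<phi>
     \<longleftrightarrow> valid_in_model W Wb R S V \<phi>"
proof -
  have "Wb = {}" using model unfolding S4I_model_def S4I_frame_def infallible_def by simp
  then show ?thesis using image_sat unfolding valid_in_model_def by auto
qed

end

theorem mainTheorem3:
  fixes \<phi> :: fm
  assumes "\<not> S4I_deriv \<phi>"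
  shows "\<exists>(W :: nat set) Wb R S V. finite W \<and> S4I_model W Wb R S V \<and>
           \<not> valid_in_model W Wb R S V \<phi>"
proof -
  obtain P :: "ltree list set" and R S V where
    P: "finite P" "S4I_model P {} R S V" "\<not> valid_in_model P {} R S V \<phi>"
    using S4I_finite_path_model[OF canon_model S4I_complete[OF assms]] by blast
  \<comment> \<open>The conclusion asks for worlds in \<open>nat\<close>, so the finite path model
    is renamed along an injection.\<close>
  obtain f :: "ltree list \<Rightarrow> nat" where f: "inj_on f P"
    using finite_imp_inj_to_nat_seg[OF P(1)] by blast
  show ?thesis
    using image_model[OF f P(2)] image_valid[OF f P(2)] P(1,3) by blast
qed

end
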